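(* Let $n>2$ be an integer and let $G=\mathrm{Dc}_n$ be the dicyclic group of order $4n$ with generators $x,y$. A group homomorphism $\varphi: G\to G$ is an automorphism of $G$ if and only if $\varphi(x)=x^r$ and $\varphi(y)=yx^s$ for some $r\in\mathcal{U}_{2n}$ and some $s\in\mathbb{Z}_{2n}$.
   Context: $\mathrm{Dc}_n=\langle x,y \mid x^{2n}=1,\ y^2=x^n,\ y^{-1}xy=x^{-1}\rangle$ is the dicyclic group of order $4n$. $\mathbb{Z}_{2n}$ denotes the integers modulo $2n$, and $\mathcal{U}_{2n}$ denotes the set of units of $\mathbb{Z}_{2n}$. Exponents of $x$ are read modulo $2n$. *)

theory Defs
  imports "HOL-Algebra.Group" "HOL-Number_Theory.Residues"
begin

text \<open>
  A group presentation: the generators are the elements of the type \<open>'g\<close>, the relations \<open>l = r\<close>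
  are pairs \<open>(l, r)\<close> of words in the generators and their formal inverses, and the group presented
  is the set of words modulo the least congruence containing free cancellation and the relations.
\<close>

datatype 'g letter = Gen 'g | GenInv 'g

inductive pres_eq :: "('g letter list \<times> 'g letter list) set \<Rightarrow> 'g letter list \<Rightarrow> 'g letter list \<Rightarrow> bool"
  for R where
  refl: "pres_eq R u u"
| sym: "pres_eq R u v \<Longrightarrow> pres_eq R v u"
| trans: "pres_eq R u v \<Longrightarrow> pres_eq R v w \<Longrightarrow> pres_eq R u w"
| cancel_right: "pres_eq R (u @ [Gen a, GenInv a] @ v) (u @ v)"
| cancel_left: "pres_eq R (u @ [GenInv a, Gen a] @ v) (u @ v)"
| relation: "(l, r) \<in> R \<Longrightarrow> pres_eq R (u @ l @ v) (u @ r @ v)"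

definition pres_class :: "('g letter list \<times> 'g letter list) set \<Rightarrow> 'g letter list \<Rightarrow> 'g letter list set" where
  "pres_class R u = {v. pres_eq R u v}"

definition presented_group :: "('g letter list \<times> 'g letter list) set \<Rightarrow> 'g letter list set monoid" where
  "presented_group R =
    \<lparr>carrier = range (pres_class R),
     monoid.mult = (\<lambda>A B. \<Union>u\<in>A. \<Union>v\<in>B. pres_class R (u @ v)),
     one = pres_class R []\<rparr>"

datatype dc_gen = X | Y

definition dc_relations :: "nat \<Rightarrow> (dc_gen letter list \<times> dc_gen letter list) set" where
  "dc_relations n =
    {(replicate (2 * n) (Gen X), []),
     ([Gen Y, Gen Y], replicate n (Gen X)),
     ([GenInv Y, Gen X, Gen Y], [GenInv X])}"

definition Dc :: "nat \<Rightarrow> dc_gen letter list set monoid" where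
  "Dc n = presented_group (dc_relations n)"

definition dc_x :: "nat \<Rightarrow> dc_gen letter list set" where
  "dc_x n = pres_class (dc_relations n) [Gen X]"

definition dc_y :: "nat \<Rightarrow> dc_gen letter list set" where
  "dc_y n = pres_class (dc_relations n) [Gen Y]"

lemma pres_class_eq_iff: "pres_class R u = pres_class R v \<longleftrightarrow> pres_eq R u v"
proof
  assume "pres_class R u = pres_class R v"
  moreover have "v \<in> pres_class R v" by (simp add: pres_class_def pres_eq.refl)
  ultimately have "v \<in> pres_class R u" by simp
  then show "pres_eq R u v" by (simp add: pres_class_def)
next
  assume "pres_eq R u v"
  then show "pres_class R u = pres_class R v"
    unfolding pres_class_def by (auto intro: pres_eq.trans[of R u v] pres_eq.trans[OF pres_eq.sym, of R u v])
qed

lemma pres_eq_append_left: "pres_eq R u v \<Longrightarrow> pres_eq R (w @ u) (w @ v)"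
proof (induction rule: pres_eq.induct)
  case (cancel_right u a v)
  show ?case using pres_eq.cancel_right[of R "w @ u" a v] by simp
next
  case (cancel_left u a v)
  show ?case using pres_eq.cancel_left[of R "w @ u" a v] by simp
next
  case (relation l r u v)
  then show ?case using pres_eq.relation[of l r R "w @ u" v] by simp
qed (rule pres_eq.refl, erule pres_eq.sym, erule pres_eq.trans, assumption)

lemma pres_eq_append_right: "pres_eq R u v \<Longrightarrow> pres_eq R (u @ w) (v @ w)"
proof (induction rule: pres_eq.induct)
  case (cancel_right u a v)
  show ?case using pres_eq.cancel_right[of R u a "v @ w"] by simp
next
  case (cancel_left u a v)
  show ?case using pres_eq.cancel_left[of R u a "v @ w"] by simp
next
  case (relation l r u v)
  then show ?case using pres_eq.relation[of l r R u "v @ w"] by simp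
qed (rule pres_eq.refl, erule pres_eq.sym, erule pres_eq.trans, assumption)

lemma pres_eq_append: "pres_eq R u u' \<Longrightarrow> pres_eq R v v' \<Longrightarrow> pres_eq R (u @ v) (u' @ v')"
  by (rule pres_eq.trans[OF pres_eq_append_right pres_eq_append_left])

lemma presented_group_mult:
  "pres_class R u \<otimes>\<^bsub>presented_group R\<^esub> pres_class R v = pres_class R (u @ v)"
proof -
  have "pres_class R (u' @ v') = pres_class R (u @ v)"
    if "u' \<in> pres_class R u" "v' \<in> pres_class R v" for u' v'
  proof -
    have "pres_eq R u u'" "pres_eq R v v'"
      using that by (simp_all add: pres_class_def)
    then have "pres_eq R (u @ v) (u' @ v')"
      by (rule pres_eq_append)
    then show ?thesis
      unfolding pres_class_eq_iff by (rule pres_eq.sym)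
  qed
  then have "(\<Union>u'\<in>pres_class R u. \<Union>v'\<in>pres_class R v. pres_class R (u' @ v')) =
      (\<Union>u'\<in>pres_class R u. \<Union>v'\<in>pres_class R v. pres_class R (u @ v))"
    by (intro SUP_cong HOL.refl)
  moreover have "pres_class R u \<noteq> {}" "pres_class R v \<noteq> {}"
    using pres_eq.refl by (auto simp: pres_class_def)
  ultimately show ?thesis
    by (simp add: presented_group_def)
qed

lemma pres_eq_left_inverse: "\<exists>v. pres_eq R (v @ u) []"
proof (induction u)
  case Nil
  then show ?case using pres_eq.refl[of R "[]"] by auto
next
  case (Cons c u)
  then obtain v where v: "pres_eq R (v @ u) []" by blast
  obtain d where "pres_eq R (v @ [d, c] @ u) (v @ u)"
  proof (cases c)
    case (Gen a)
    then show ?thesis using that[of "GenInv a"] pres_eq.cancel_left[of R v a u] by simp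
  next
    case (GenInv a)
    then show ?thesis using that[of "Gen a"] pres_eq.cancel_right[of R v a u] by simp
  qed
  then have "pres_eq R ((v @ [d]) @ c # u) []"
    using pres_eq.trans[OF _ v, of "v @ [d, c] @ u"] by simp
  then show ?case by blast
qed

lemma group_presented_group: "group (presented_group R)"
proof (rule groupI)
  fix A assume "A \<in> carrier (presented_group R)"
  then obtain u where u: "A = pres_class R u" by (auto simp: presented_group_def)
  obtain v where "pres_eq R (v @ u) []" using pres_eq_left_inverse by blast
  then have "pres_class R v \<otimes>\<^bsub>presented_group R\<^esub> A = \<one>\<^bsub>presented_group R\<^esub>"
    by (simp add: u presented_group_mult pres_class_eq_iff) (simp add: presented_group_def pres_class_eq_iff)
  then show "\<exists>B\<in>carrier (presented_group R). B \<otimes>\<^bsub>presented_group R\<^esub> A = \<one>\<^bsub>presented_group R\<^esub>"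
    by (auto simp: presented_group_def)
next
  have one: "\<one>\<^bsub>presented_group R\<^esub> = pres_class R []"
    and car: "carrier (presented_group R) = range (pres_class R)"
    by (simp_all add: presented_group_def)
  show "\<one>\<^bsub>presented_group R\<^esub> \<in> carrier (presented_group R)" by (simp add: one car)
  fix A B C
  assume A: "A \<in> carrier (presented_group R)"
  then show "\<one>\<^bsub>presented_group R\<^esub> \<otimes>\<^bsub>presented_group R\<^esub> A = A"
    by (auto simp: one car presented_group_mult)
  assume B: "B \<in> carrier (presented_group R)"
  show "A \<otimes>\<^bsub>presented_group R\<^esub> B \<in> carrier (presented_group R)"
    using A B by (auto simp: car presented_group_mult)
  assume C: "C \<in> carrier (presented_group R)"
  show "A \<otimes>\<^bsub>presented_group R\<^esub> B \<otimes>\<^bsub>presented_group R\<^esub> C =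
      A \<otimes>\<^bsub>presented_group R\<^esub> (B \<otimes>\<^bsub>presented_group R\<^esub> C)"
    using A B C by (auto simp: car presented_group_mult)
qed

lemma group_Dc: "group (Dc n)"
  unfolding Dc_def by (rule group_presented_group)

end

theory Submission
  imports Defs "HOL-Algebra.Generated_Groups"
begin

text \<open>
  The relation \<open>y\<inverse> x y = x\<inverse>\<close> moves every power of \<open>x\<close> to the right of every \<open>y\<close>, and \<open>y\<^sup>2 = x\<^sup>n\<close>
  then leaves only the elements \<open>x\<^sup>k\<close> and \<open>y x\<^sup>k\<close> (\<open>normal_form\<close>).  Beyond this, the only
  fact about the group that matters is that \<open>x\<close> has order exactly \<open>2n\<close>.

  An automorphism \<open>\<phi>\<close> preserves orders.  Elements \<open>y x\<^sup>k\<close> satisfy \<open>(y x\<^sup>k)\<^sup>4 = 1\<close>, whereas \<open>2n > 4\<close>, so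
  \<open>\<phi> x\<close> must be a power \<open>x\<^sup>r\<close>, and its order is \<open>2n\<close> only if \<open>r\<close> is a unit modulo \<open>2n\<close>.
  If \<open>\<phi> y\<close> were also a power of \<open>x\<close>, then \<open>\<phi> x\<close> and \<open>\<phi> y\<close> would commute, although \<open>x\<close> and
  \<open>y\<close> do not; hence \<open>\<phi> y = y x\<^sup>s\<close>.  Conversely, if \<open>r\<close> is invertible modulo \<open>2n\<close>, then \<open>x\<close> is a
  power of \<open>\<phi> x\<close> and \<open>y\<close> is a product of \<open>\<phi> y\<close> with such a power.  So \<open>\<phi>\<close> is surjective, and an
  endomorphism of a finite group that is surjective is bijective.

  That the order of \<open>x\<close> in the presented group is no smaller than \<open>2n\<close> cannot be read off
  the relations: it needs a model in which they hold and \<open>x\<close> has this order.  The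
  model here is the two-dimensional complex representation in which \<open>x\<close> is diagonal with entries
  \<open>\<zeta>\<close> and \<open>\<zeta>\<inverse>\<close>, where \<open>\<zeta> = exp (i\<pi>/n)\<close>, and \<open>y\<close> is the rotation by a right angle
  (\<open>dc_action\<close>, \<open>dc_x_pow_eq_one_imp_dvd\<close>).
\<close>

section \<open>Groups with the dicyclic relations\<close>

text \<open>
  Working with an abstract group keeps the words of the presentation out of the
  argument.  The relation \<open>x\<^sup>2\<^sup>n = 1\<close> is contained in the sharper condition on the order of \<open>x\<close>.
\<close>

locale dicyclic = group G for G (structure) +
  fixes x y and n :: nat
  assumes x_closed [simp]: "x \<in> carrier G"
    and y_closed [simp]: "y \<in> carrier G"
    and generated: "carrier G = generate G {x, y}"
    and n_pos: "n > 0"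
    and ord_x: "ord x = 2 * n"
    and y_square: "y \<otimes> y = x [^] n"
    and conj_y: "inv y \<otimes> x \<otimes> y = inv x"
begin

lemma pow_x_eq_iff: "x [^] (j::int) = x [^] (k::int) \<longleftrightarrow> [j = k] (mod (2 * int n))"
  using int_pow_eq[of x j k] by (simp add: ord_x cong_iff_dvd_diff dvd_diff_commute)

lemma pow_x_eq_one_iff: "x [^] (k::int) = \<one> \<longleftrightarrow> 2 * int n dvd k"
  using int_pow_eq_id[of x k] by (simp add: ord_x)

text \<open>Conjugation by \<open>y\<close> is an endomorphism, so it inverts all powers of \<open>x\<close> because it inverts \<open>x\<close>.\<close>

lemma pow_x_mult_y: "x [^] (k::int) \<otimes> y = y \<otimes> x [^] (- k)"
proof -
  have "y \<otimes> (inv y \<otimes> g) = g" if "g \<in> carrier G" for g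
    using that by (simp add: m_assoc[symmetric])
  then have "(\<lambda>g. inv y \<otimes> g \<otimes> y) \<in> hom G G"
    by (intro homI) (auto simp: m_assoc)
  then have "inv y \<otimes> x [^] k \<otimes> y = (inv y \<otimes> x \<otimes> y) [^] k"
    using hom_int_pow[of "\<lambda>g. inv y \<otimes> g \<otimes> y" G G x k] by (simp add: is_group)
  also have "\<dots> = x [^] (- k)"
    by (simp add: conj_y int_pow_inv int_pow_neg)
  finally have "y \<otimes> (inv y \<otimes> x [^] k \<otimes> y) = y \<otimes> x [^] (- k)"
    by simp
  then show ?thesis
    by (simp add: m_assoc[symmetric])
qed

lemma coset_mult_pow_x: "y \<otimes> x [^] (j::int) \<otimes> x [^] (k::int) = y \<otimes> x [^] (j + k)"
  by (simp add: m_assoc int_pow_mult)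

lemma pow_x_mult_coset: "x [^] (j::int) \<otimes> (y \<otimes> x [^] (k::int)) = y \<otimes> x [^] (k - j)"
proof -
  have "x [^] j \<otimes> (y \<otimes> x [^] k) = y \<otimes> x [^] (- j) \<otimes> x [^] k"
    by (simp add: m_assoc[symmetric] pow_x_mult_y)
  then show ?thesis
    by (simp add: coset_mult_pow_x)
qed

lemma coset_mult_coset:
  "y \<otimes> x [^] (j::int) \<otimes> (y \<otimes> x [^] (k::int)) = x [^] (int n + k - j)"
proof -
  have "y \<otimes> x [^] j \<otimes> (y \<otimes> x [^] k) = y \<otimes> y \<otimes> x [^] (k - j)"
    by (simp add: m_assoc pow_x_mult_coset)
  also have "\<dots> = x [^] int n \<otimes> x [^] (k - j)"
    by (simp add: y_square int_pow_int)
  finally show ?thesis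
    by (simp add: int_pow_mult[symmetric] add_diff_eq)
qed

text \<open>This separates the coset \<open>y\<langle>x\<rangle>\<close> from the elements of order \<open>2n\<close> once \<open>2n > 4\<close>.\<close>

lemma coset_pow_4: "(y \<otimes> x [^] (k::int)) [^] (4::nat) = \<one>"
proof -
  let ?z = "y \<otimes> x [^] k"
  have "?z [^] (4::nat) = (?z \<otimes> ?z) \<otimes> (?z \<otimes> ?z)"
    by (simp add: numeral_eq_Suc m_assoc)
  also have "\<dots> = x [^] (2 * int n)"
    by (simp add: coset_mult_coset int_pow_mult[symmetric])
  finally show ?thesis
    by (simp add: pow_x_eq_one_iff)
qed

text \<open>
  The elements of these two shapes are closed under products, and they contain the
  generators and their inverses; in particular \<open>y\<inverse> = y x\<^sup>-\<^sup>n\<close>.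
\<close>

lemma normal_form:
  assumes "g \<in> carrier G"
  obtains k :: int where "g = x [^] k" | k :: int where "g = y \<otimes> x [^] k"
proof -
  have "g \<in> generate G {x, y}"
    using assms generated by simp
  then have "\<exists>k::int. g = x [^] k \<or> g = y \<otimes> x [^] k"
  proof (induction rule: generate.induct)
    case one
    show ?case by (rule exI[of _ 0]) simp
  next
    case (incl h)
    then show ?case
      by (metis insert_iff empty_iff int_pow_1 int_pow_0 r_one x_closed y_closed)
  next
    case (inv h)
    have "y \<otimes> x [^] (- int n) \<otimes> y = \<one>"
      using coset_mult_coset[of "- int n" 0] by (simp add: pow_x_eq_one_iff)
    then have "inv y = y \<otimes> x [^] (- int n)"
      by (intro inv_equality) auto
    moreover have "inv x = x [^] (- 1 :: int)"
      by (simp add: int_pow_neg)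
    ultimately show ?case
      using inv by blast
  next
    case (eng g h)
    then show ?case
      by (metis int_pow_mult coset_mult_pow_x pow_x_mult_coset coset_mult_coset x_closed)
  qed
  then show ?thesis
    using that by blast
qed

lemma finite_carrier: "finite (carrier G)"
proof (rule finite_subset)
  let ?K = "{0..<2 * int n}"
  show "carrier G \<subseteq> (\<lambda>k. x [^] k) ` ?K \<union> (\<lambda>k. y \<otimes> x [^] k) ` ?K"
  proof
    fix g assume "g \<in> carrier G"
    moreover have "x [^] k = x [^] (k mod (2 * int n))" for k :: int
      by (simp add: pow_x_eq_iff cong_def)
    moreover have "k mod (2 * int n) \<in> ?K" for k
      using n_pos by simp
    ultimately show "g \<in> (\<lambda>k. x [^] k) ` ?K \<union> (\<lambda>k. y \<otimes> x [^] k) ` ?K"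
      by (elim normal_form) (metis UnCI imageI)+
  qed
qed simp

section \<open>Automorphisms\<close>

lemma hom_pow_x:
  assumes "\<phi> \<in> hom G G"
  shows "\<phi> (x [^] (k::int)) = \<phi> x [^] k"
  using hom_int_pow[OF assms x_closed is_group is_group] .

lemma iso_if_images:
  assumes hom: "\<phi> \<in> hom G G"
    and r: "coprime r (2 * int n)"
    and x: "\<phi> x = x [^] (r::int)" and y: "\<phi> y = y \<otimes> x [^] (s::int)"
  shows "\<phi> \<in> iso G G"
proof -
  obtain t where "[r * t = 1] (mod (2 * int n))"
    using cong_solve_coprime_int[OF r] by blast
  then have t: "[r * (t * k) = k] (mod (2 * int n))" for k
    using cong_scalar_right[of "r * t" 1 "2 * int n" k] by (simp add: mult.assoc)
  \<comment> \<open>With \<open>t\<close> the inverse of \<open>r\<close>, every normal form has an explicit preimage.\<close>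
  have pow: "\<phi> (x [^] (t * k)) = x [^] k" for k :: int
    by (simp add: hom_pow_x[OF hom] x int_pow_pow pow_x_eq_iff t)
  have coset: "\<phi> (y \<otimes> x [^] (t * (k - s))) = y \<otimes> x [^] k" for k :: int
    using hom_mult[OF hom, of y "x [^] (t * (k - s))"]
    by (simp add: pow y coset_mult_pow_x)
  have "carrier G \<subseteq> \<phi> ` carrier G"
  proof
    fix g assume "g \<in> carrier G"
    then show "g \<in> \<phi> ` carrier G"
      by (elim normal_form)
        (metis pow coset imageI int_pow_closed m_closed x_closed y_closed)+
  qed
  moreover have "\<phi> ` carrier G \<subseteq> carrier G"
    using hom by (auto simp: hom_def)
  ultimately have surj: "\<phi> ` carrier G = carrier G"
    by blast
  then have "inj_on \<phi> (carrier G)"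
    by (intro eq_card_imp_inj_on finite_carrier) simp
  then show ?thesis
    using hom surj by (simp add: iso_def bij_betw_def)
qed

lemma images_if_iso:
  assumes n: "n > 2" and iso: "\<phi> \<in> iso G G"
  obtains r s :: int where "coprime r (2 * int n)" "\<phi> x = x [^] r" "\<phi> y = y \<otimes> x [^] s"
proof -
  have hom: "\<phi> \<in> hom G G" and inj: "inj_on \<phi> (carrier G)"
    using iso by (auto simp: iso_def bij_betw_def)
  interpret \<phi>: group_hom G G \<phi>
    by (simp add: group_hom_def group_hom_axioms_def hom is_group)
  have order: "2 * int n dvd k" if "\<phi> x [^] k = \<one>" for k :: int
  proof -
    have "\<phi> (x [^] k) = \<phi> \<one>"
      by (simp add: hom_pow_x[OF hom] that)
    then have "x [^] k = \<one>"
      by (rule inj_onD[OF inj]) auto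
    then show ?thesis
      by (simp add: pow_x_eq_one_iff)
  qed
  have "\<phi> x \<noteq> y \<otimes> x [^] k" for k :: int
  proof
    assume "\<phi> x = y \<otimes> x [^] k"
    then have "\<phi> x [^] int 4 = \<one>"
      by (simp only: int_pow_int coset_pow_4)
    then have "2 * int n dvd 4"
      using order by simp
    then show False
      using n zdvd_imp_le[of "2 * int n" 4] by simp
  qed
  then obtain r :: int where r: "\<phi> x = x [^] r"
    by (meson normal_form \<phi>.hom_closed x_closed)
  have "coprime r (2 * int n)"
  proof -
    \<comment> \<open>For \<open>d = gcd r (2n)\<close>, the power \<open>2n/d\<close> already kills \<open>x\<^sup>r\<close>, so \<open>d\<close> must be 1.\<close>
    define d where "d = gcd r (2 * int n)"
    obtain q m where q: "r = d * q" and m: "2 * int n = d * m"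
      unfolding d_def by (meson dvdE gcd_dvd1 gcd_dvd2)
    have "r * m = 2 * int n * q"
      by (simp add: q m)
    then have "\<phi> x [^] m = \<one>"
      by (simp add: r int_pow_pow pow_x_eq_one_iff)
    then have "d * m dvd m"
      using order m by metis
    moreover have "m \<noteq> 0"
      using m n_pos by auto
    ultimately have "is_unit d"
      using dvd_mult_cancel_right[of d m 1] by simp
    then show ?thesis
      by (simp add: d_def coprime_iff_gcd_eq_1)
  qed
  moreover have "\<phi> y \<noteq> x [^] k" for k :: int
  proof
    assume k: "\<phi> y = x [^] k"
    have "\<phi> (x \<otimes> y) = \<phi> (y \<otimes> x)"
      by (simp add: r k int_pow_mult[symmetric] add.commute)
    then have "x \<otimes> y = y \<otimes> x"
      by (rule inj_onD[OF inj]) auto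
    moreover have "x \<otimes> y = y \<otimes> x [^] (- 1 :: int)"
      using pow_x_mult_y[of 1] by simp
    ultimately have "x [^] (- 1 :: int) = x [^] (1 :: int)"
      by simp
    then have "[- 1 = 1] (mod (2 * int n))"
      by (simp only: pow_x_eq_iff)
    then have "2 * int n dvd - 2"
      by (simp only: cong_iff_dvd_diff) simp
    then show False
      using n zdvd_imp_le[of "2 * int n" 2] by simp
  qed
  then obtain s :: int where "\<phi> y = y \<otimes> x [^] s"
    by (meson normal_form \<phi>.hom_closed y_closed)
  ultimately show ?thesis
    using that r by blast
qed

text \<open>Exponents of \<open>x\<close> only matter modulo \<open>2n\<close>, so they can be taken among the residues.\<close>

lemma iso_iff_images:
  assumes n: "n > 2" and hom: "\<phi> \<in> hom G G"
  shows "\<phi> \<in> iso G G \<longleftrightarrow>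
    (\<exists>r \<in> Units (residue_ring (2 * int n)). \<exists>s \<in> carrier (residue_ring (2 * int n)).
       \<phi> x = x [^] r \<and> \<phi> y = y \<otimes> x [^] s)"
proof -
  interpret R: residues "2 * int n" "residue_ring (2 * int n)"
    using n_pos by unfold_locales auto
  have units: "Units (residue_ring (2 * int n)) =
      {r. 0 < r \<and> r < 2 * int n \<and> coprime r (2 * int n)}"
    by (rule R.res_units_eq)
  have carrier: "carrier (residue_ring (2 * int n)) = {0..2 * int n - 1}"
    by (rule R.res_carrier_eq)
  show ?thesis
  proof
    assume "\<phi> \<in> iso G G"
    then obtain r s :: int
      where rs: "coprime r (2 * int n)" "\<phi> x = x [^] r" "\<phi> y = y \<otimes> x [^] s"
      using images_if_iso[OF n] by blast
    have reduce: "x [^] k = x [^] (k mod (2 * int n))" for k :: int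
      by (simp add: pow_x_eq_iff cong_def)
    have "coprime (r mod (2 * int n)) (2 * int n)"
      using rs(1) n_pos by (subst coprime_mod_left_iff) auto
    \<comment> \<open>The residue 0 is excluded because it is coprime to the modulus only if the modulus is 1.\<close>
    moreover from this have "r mod (2 * int n) \<noteq> 0"
      using n by (intro notI) simp
    then have "0 < r mod (2 * int n)"
      using n_pos pos_mod_sign[of "2 * int n" r] by linarith
    ultimately have "r mod (2 * int n) \<in> Units (residue_ring (2 * int n))"
      using n_pos by (simp add: units)
    moreover have "s mod (2 * int n) \<in> carrier (residue_ring (2 * int n))"
      using n_pos by (simp add: carrier)
    moreover have "\<phi> x = x [^] (r mod (2 * int n))"
      "\<phi> y = y \<otimes> x [^] (s mod (2 * int n))"
      using rs(2,3) by (simp_all flip: reduce)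
    ultimately show "\<exists>r \<in> Units (residue_ring (2 * int n)).
        \<exists>s \<in> carrier (residue_ring (2 * int n)). \<phi> x = x [^] r \<and> \<phi> y = y \<otimes> x [^] s"
      by blast
  qed (use iso_if_images[OF hom] units in blast)
qed

end

section \<open>The presented group is dicyclic\<close>

text \<open>
  This is how inequalities are proved in a presented group: two words that act
  differently in some model of the relations represent different elements.
\<close>

lemma pres_eq_fold:
  assumes "pres_eq R u v"
    and "\<And>a. f (GenInv a) \<circ> f (Gen a) = id"
    and "\<And>a. f (Gen a) \<circ> f (GenInv a) = id"
    and "\<And>l r. (l, r) \<in> R \<Longrightarrow> fold f l = fold f r"
  shows "fold f u = fold f v"
  using assms by (induction rule: pres_eq.induct) (simp_all add: comp_assoc)

lemma pres_class_in_carrier: "pres_class R u \<in> carrier (presented_group R)"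
  by (simp add: presented_group_def)

lemma one_presented_group: "\<one>\<^bsub>presented_group R\<^esub> = pres_class R []"
  by (simp add: presented_group_def)

lemma inv_pres_class_Gen:
  "inv\<^bsub>presented_group R\<^esub> (pres_class R [Gen a]) = pres_class R [GenInv a]"
proof (rule group.inv_equality[OF group_presented_group])
  show "pres_class R [GenInv a] \<otimes>\<^bsub>presented_group R\<^esub> pres_class R [Gen a] =
      \<one>\<^bsub>presented_group R\<^esub>"
    using pres_eq.cancel_left[of R "[]" a "[]"]
    by (simp add: presented_group_mult one_presented_group pres_class_eq_iff)
qed (rule pres_class_in_carrier)+

lemma pres_class_replicate:
  "pres_class R [Gen a] [^]\<^bsub>presented_group R\<^esub> (k::nat) = pres_class R (replicate k (Gen a))"
proof (induction k)
  case 0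
  interpret group "presented_group R" by (rule group_presented_group)
  show ?case by (simp add: one_presented_group)
next
  case (Suc k)
  interpret group "presented_group R" by (rule group_presented_group)
  show ?case
    by (simp add: Suc presented_group_mult replicate_append_same)
qed

lemma presented_group_generated:
  "carrier (presented_group R) = generate (presented_group R) (range (\<lambda>a. pres_class R [Gen a]))"
  (is "_ = generate ?G ?S")
proof
  interpret group ?G by (rule group_presented_group)
  show "generate ?G ?S \<subseteq> carrier ?G"
    by (rule generate_incl) (auto simp: pres_class_in_carrier)
  have "pres_class R u \<in> generate ?G ?S" for u
  proof (induction u)
    case Nil
    show ?case
      using generate.one[of ?G ?S] by (simp add: one_presented_group)
  next
    case (Cons c u)
    have "pres_class R [c] \<in> generate ?G ?S"
    proof (cases c)
      case (Gen a)
      then show ?thesis by (auto intro: generate.incl)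
    next
      case (GenInv a)
      then show ?thesis
        using generate.inv[of "pres_class R [Gen a]" ?S ?G] by (simp add: inv_pres_class_Gen)
    qed
    from generate.eng[OF this Cons] show ?case
      by (simp add: presented_group_mult)
  qed
  then show "carrier ?G \<subseteq> generate ?G ?S"
    by (auto simp: presented_group_def)
qed

text \<open>
  For \<open>z = exp (i\<pi>/n)\<close> this is the classical embedding of the dicyclic group into the unit
  quaternions, regarded as \<open>SU(2)\<close> acting on \<open>\<complex>\<^sup>2\<close>.  A word acts through its letters from left to
  right, so it is a right action.
\<close>

fun dc_action :: "complex \<Rightarrow> dc_gen letter \<Rightarrow> complex \<times> complex \<Rightarrow> complex \<times> complex" where
  "dc_action z (Gen X) (a, b) = (z * a, inverse z * b)"
| "dc_action z (GenInv X) (a, b) = (inverse z * a, z * b)"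
| "dc_action z (Gen Y) (a, b) = (- b, a)"
| "dc_action z (GenInv Y) (a, b) = (b, - a)"

lemma dc_action_funpow:
  "(dc_action z (Gen X) ^^ k) (a, b) = (z ^ k * a, inverse z ^ k * b)"
  by (induction k) (simp_all add: algebra_simps)

text \<open>
  The relations hold in this model as soon as \<open>z\<^sup>n = -1\<close>, since both \<open>x\<^sup>n\<close> and \<open>y\<^sup>2\<close> then act as
  the scalar \<open>-1\<close>.
\<close>

lemma pres_eq_dc_action:
  assumes "pres_eq (dc_relations n) u v" and z: "z ^ n = - 1" "z \<noteq> 0"
  shows "fold (dc_action z) u = fold (dc_action z) v"
  using assms(1)
proof (rule pres_eq_fold)
  show "dc_action z (GenInv a) \<circ> dc_action z (Gen a) = id"
    "dc_action z (Gen a) \<circ> dc_action z (GenInv a) = id" for a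
    using z(2) by (cases a; force)+
  fix l r assume "(l, r) \<in> dc_relations n"
  moreover have "fold (dc_action z) (replicate (2 * n) (Gen X)) = fold (dc_action z) []"
    by (rule ext) (auto simp: dc_action_funpow mult_2 power_add z power_inverse)
  moreover have "fold (dc_action z) [Gen Y, Gen Y] = fold (dc_action z) (replicate n (Gen X))"
    by (rule ext) (auto simp: dc_action_funpow z power_inverse)
  moreover have "fold (dc_action z) [GenInv Y, Gen X, Gen Y] = fold (dc_action z) [GenInv X]"
    by (rule ext) auto
  ultimately show "fold (dc_action z) l = fold (dc_action z) r"
    unfolding dc_relations_def by blast
qed

lemma cis_pi_div_power_eq_one_imp_dvd:
  assumes "n > 0" "cis (pi / real n) ^ k = 1"
  shows "2 * n dvd k"
proof -
  have "cos (real k * (pi / real n)) = 1"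
    using assms(2) by (simp add: DeMoivre complex_eq_iff)
  then obtain m :: int where "real k * (pi / real n) = real_of_int m * 2 * pi"
    unfolding cos_one_2pi_int by blast
  then have "real k = real n * (real_of_int m * 2)"
    using assms(1) by (simp add: field_simps)
  then have "real_of_int (int k) = real_of_int (2 * int n * m)"
    by (simp add: mult.commute)
  then have "int k = 2 * int n * m"
    by (simp only: of_int_eq_iff)
  then have "int (2 * n) dvd int k"
    by simp
  then show ?thesis
    by (simp only: of_nat_dvd_iff)
qed

lemma dc_x_pow_eq_one_imp_dvd:
  assumes "n > 0" "dc_x n [^]\<^bsub>Dc n\<^esub> (k::nat) = \<one>\<^bsub>Dc n\<^esub>"
  shows "2 * n dvd k"
proof -
  let ?z = "cis (pi / real n)"
  have "pres_eq (dc_relations n) (replicate k (Gen X)) []"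
    using assms(2)
    by (simp add: Dc_def dc_x_def pres_class_replicate one_presented_group pres_class_eq_iff)
  moreover have "?z ^ n = - 1"
    using assms(1) by (simp add: DeMoivre)
  ultimately have "fold (dc_action ?z) (replicate k (Gen X)) (1, 1) = fold (dc_action ?z) [] (1, 1)"
    using pres_eq_dc_action cis_neq_zero by metis
  then have "?z ^ k = 1"
    by (simp add: dc_action_funpow)
  then show ?thesis
    using assms(1) by (rule cis_pi_div_power_eq_one_imp_dvd[rotated])
qed

lemma dicyclic_Dc:
  assumes "n > 0"
  shows "dicyclic (Dc n) (dc_x n) (dc_y n) n"
proof -
  interpret group "Dc n" by (rule group_Dc)
  have rel: "pres_class (dc_relations n) l = pres_class (dc_relations n) r"
    if "(l, r) \<in> dc_relations n" for l r
    using pres_eq.relation[OF that, of "[]" "[]"] by (simp add: pres_class_eq_iff)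
  have x: "dc_x n \<in> carrier (Dc n)"
    by (simp add: dc_x_def Dc_def pres_class_in_carrier)
  have UNIV: "(UNIV :: dc_gen set) = {X, Y}"
    by (auto intro: dc_gen.exhaust)
  have "range (\<lambda>a. pres_class (dc_relations n) [Gen a]) = {dc_x n, dc_y n}"
    unfolding UNIV by (simp add: dc_x_def dc_y_def)
  then have gen: "carrier (Dc n) = generate (Dc n) {dc_x n, dc_y n}"
    using presented_group_generated[of "dc_relations n"] by (simp add: Dc_def)
  have "dc_x n [^]\<^bsub>Dc n\<^esub> (2 * n) = \<one>\<^bsub>Dc n\<^esub>"
    using rel[of "replicate (2 * n) (Gen X)" "[]"]
    by (simp add: dc_x_def Dc_def pres_class_replicate one_presented_group dc_relations_def)
  then have "ord (dc_x n) dvd 2 * n"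
    by (simp only: pow_eq_id[OF x])
  moreover have "2 * n dvd ord (dc_x n)"
    using dc_x_pow_eq_one_imp_dvd[OF assms pow_ord_eq_1[OF x]] .
  ultimately have ord: "ord (dc_x n) = 2 * n"
    by (rule dvd_antisym)
  show ?thesis
  proof unfold_locales
    show "dc_y n \<in> carrier (Dc n)"
      by (simp add: dc_y_def Dc_def pres_class_in_carrier)
    show "dc_y n \<otimes>\<^bsub>Dc n\<^esub> dc_y n = dc_x n [^]\<^bsub>Dc n\<^esub> n"
      using rel[of "[Gen Y, Gen Y]" "replicate n (Gen X)"]
      by (simp add: dc_x_def dc_y_def Dc_def pres_class_replicate presented_group_mult
          dc_relations_def)
    show "inv\<^bsub>Dc n\<^esub> (dc_y n) \<otimes>\<^bsub>Dc n\<^esub> dc_x n \<otimes>\<^bsub>Dc n\<^esub> dc_y n = inv\<^bsub>Dc n\<^esub> (dc_x n)"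
      using rel[of "[GenInv Y, Gen X, Gen Y]" "[GenInv X]"]
      by (simp add: dc_x_def dc_y_def Dc_def inv_pres_class_Gen presented_group_mult
          dc_relations_def)
  qed (fact assms x gen ord)+
qed

theorem theorem2p3:
  fixes n :: nat and \<phi> :: "dc_gen letter list set \<Rightarrow> dc_gen letter list set"
  assumes "n > 2" and "\<phi> \<in> hom (Dc n) (Dc n)"
  shows "\<phi> \<in> iso (Dc n) (Dc n) \<longleftrightarrow>
    (\<exists>r \<in> Units (residue_ring (2 * int n)). \<exists>s \<in> carrier (residue_ring (2 * int n)).
       \<phi> (dc_x n) = dc_x n [^]\<^bsub>Dc n\<^esub> r \<and>
       \<phi> (dc_y n) = dc_y n \<otimes>\<^bsub>Dc n\<^esub> (dc_x n [^]\<^bsub>Dc n\<^esub> s))"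
proof -
  have "n > 0"
    using assms(1) by simp
  from dicyclic.iso_iff_images[OF dicyclic_Dc[OF this] assms] show ?thesis .
qed

end
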